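(* For every integer $k\geq 2$ there exists a constant $c=c(k)>0$ such that the following holds. Let $r$ be a positive integer and let $G$ be a linear $k$-uniform hypergraph on $n$ vertices with at least $$c\, r^{\frac{1}{k-1}}n^{2-\frac{1}{k-1}}(\log n)^{2k+\frac{1}{k-1}}$$ edges. Then $G$ contains an $r$-regular subhypergraph.
   Context: A hypergraph is linear if any two distinct edges intersect in at most one vertex; $k$-uniform means all edges have size $k$. A non-empty hypergraph is $r$-regular if every vertex has degree $r$; a subhypergraph is given by a subset of edges together with the vertices they cover. $\log$ is the natural logarithm. *)

theory Defs
  imports Complex_Main
begin

text \<open>
  A hypergraph is given by its vertex set and its edge set. Multiple edges are not represented;
  a linear \<open>k\<close>-uniform hypergraph with \<open>k \<ge> 2\<close> has none.
\<close>

definition hypergraph :: "'a set \<Rightarrow> 'a set set \<Rightarrow> bool" where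
  "hypergraph V E \<longleftrightarrow> finite V \<and> (\<forall>e\<in>E. e \<subseteq> V)"

definition uniform_hypergraph :: "nat \<Rightarrow> 'a set set \<Rightarrow> bool" where
  "uniform_hypergraph k E \<longleftrightarrow> (\<forall>e\<in>E. card e = k)"

definition linear_hypergraph :: "'a set set \<Rightarrow> bool" where
  "linear_hypergraph E \<longleftrightarrow> (\<forall>e\<in>E. \<forall>f\<in>E. e \<noteq> f \<longrightarrow> card (e \<inter> f) \<le> 1)"

definition hypergraph_degree :: "'a set set \<Rightarrow> 'a \<Rightarrow> nat" where
  "hypergraph_degree E v = card {e \<in> E. v \<in> e}"

definition regular_hypergraph :: "nat \<Rightarrow> 'a set \<Rightarrow> 'a set set \<Rightarrow> bool" where
  "regular_hypergraph r V E \<longleftrightarrow> V \<noteq> {} \<and> (\<forall>v\<in>V. hypergraph_degree E v = r)"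

text \<open>The vertices of a subhypergraph are exactly those covered by its edges.\<close>

definition subhypergraph :: "'a set \<Rightarrow> 'a set set \<Rightarrow> 'a set set \<Rightarrow> bool" where
  "subhypergraph W F E \<longleftrightarrow> F \<subseteq> E \<and> W = \<Union>F"

end

theory Submission
  imports Defs "HOL-Library.FuncSet"
begin

text \<open>
  Two distinct matchings \<open>M, M'\<close> covering the same vertices give a 2-regular subhypergraph
  \<open>(M - M') \<union> (M' - M)\<close>; more generally, an \<open>r\<close>-petal sunflower of matchings covering the same
  vertices becomes \<open>r\<close>-regular once its kernel is removed. Restrict to edges whose largest degree
  is about \<open>\<Delta>\<close>; they all meet the set \<open>A\<close> of vertices of degree about \<open>\<Delta>\<close>, which has size about
  \<open>|E| / \<Delta>\<close>. A greedy count gives at least \<open>(c \<Delta>)^N\<close> matchings with \<open>N\<close> edges, where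
  \<open>N \<approx> |E| / \<Delta>\<close>, while the vertex set of such a matching has \<open>N\<close> vertices in \<open>A\<close> and \<open>(k - 1) N\<close>
  others, so there are at most \<open>(C (n / N)^(k - 1))^N\<close> vertex sets up to logarithms. Linearity gives
  \<open>\<Delta> \<le> 2 n\<close>, and for the stated number of edges some vertex set carries more than
  \<open>(32 r log n)^N\<close> matchings, enough for the sunflower theorem with the bound of Alweiss, Lovasz,
  Wu, Zhang, Rao, and Bell, Chueluecha, Warnke.
\<close>

section \<open>The improved sunflower bound\<close>

text \<open>The minimum fragment: what a cheapest member inside \<open>s i \<union> U\<close> still
  needs once \<open>U\<close> is given. Members are indexed because different indices may share a
  fragment, and the induction below counts fragments with multiplicity.\<close>

definition fragment :: "'i set \<Rightarrow> ('i \<Rightarrow> 'a set) \<Rightarrow> 'a set \<Rightarrow> 'i \<Rightarrow> 'a set" where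
  "fragment I s U i = s (arg_min (\<lambda>j. card (s j - U)) (\<lambda>j. j \<in> I \<and> s j \<subseteq> s i \<union> U)) - U"

lemma fragment_obtain:
  assumes "i \<in> I"
  obtains j where "j \<in> I" "s j \<subseteq> s i \<union> U" "fragment I s U i = s j - U"
    "\<And>h. h \<in> I \<Longrightarrow> s h \<subseteq> s i \<union> U \<Longrightarrow> card (s j - U) \<le> card (s h - U)"
proof -
  let ?P = "\<lambda>j. j \<in> I \<and> s j \<subseteq> s i \<union> U"
  let ?j = "arg_min (\<lambda>j. card (s j - U)) ?P"
  have "?P i" using assms by auto
  then have "?P ?j \<and> (\<forall>h. ?P h \<longrightarrow> card (s ?j - U) \<le> card (s h - U))"
    by (rule arg_min_nat_lemma)
  then show ?thesis by (intro that[of ?j]) (auto simp: fragment_def)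
qed

lemma fragment_subset: "i \<in> I \<Longrightarrow> fragment I s U i \<subseteq> s i - U"
  by (erule fragment_obtain[where s = s and U = U]) auto

text \<open>Expand the product of \<open>1 + q\<close> over \<open>X\<close>. In the applications
  \<open>U\<close> is the class of one colour and \<open>q\<close> counts the other colours, so both
  sides count colourings of \<open>X\<close>.\<close>

lemma sum_Pow_power_card_Diff:
  fixes q :: "'b::comm_semiring_1"
  assumes "finite X"
  shows "(\<Sum>U\<in>Pow X. q ^ card (X - U)) = (q + 1) ^ card X"
  using prod_add[OF assms, of "\<lambda>_. 1" "\<lambda>_. q"] by (simp add: add.commute)

text \<open>
  A pair \<open>(U, i)\<close> whose fragment \<open>T\<close> is large is encoded by \<open>Z = U \<union> T\<close>: by minimality \<open>T\<close> is
  contained in every member of the family inside \<open>Z\<close>, so \<open>Z\<close> leaves few candidates for \<open>T\<close>, and the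
  spread condition leaves few candidates for \<open>i\<close>.
\<close>

lemma sum_large_fragments_le:
  fixes s :: "'i \<Rightarrow> 'a set" and q :: nat and D A :: real
  assumes fin: "finite X" "finite I"
    and s: "\<And>i. i \<in> I \<Longrightarrow> s i \<subseteq> X" "\<And>i. i \<in> I \<Longrightarrow> card (s i) \<le> 2 * t"
    and spread: "\<And>Z. Z \<noteq> {} \<Longrightarrow> D ^ card Z * card {i \<in> I. Z \<subseteq> s i} \<le> A"
    and D: "D > 0" "q \<le> D" and t: "t > 0" and A: "A \<ge> 0"
  shows "(\<Sum>U\<in>Pow X. real q ^ card (X - U) * card {i \<in> I. t \<le> card (fragment I s U i)})
    \<le> (4 * q / D) ^ t * A * (real q + 1) ^ card X"
proof -
  let ?T = "\<lambda>U i. fragment I s U i"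
  \<comment> \<open>\<open>S Z\<close> is a member read off from \<open>Z\<close> alone. The default
    \<open>{}\<close> yields no codes, because \<open>T\<close> must have at least
    \<open>t > 0\<close> elements.\<close>
  define S where "S Z = (if \<exists>j\<in>I. s j \<subseteq> Z then s (SOME j. j \<in> I \<and> s j \<subseteq> Z) else {})" for Z
  have S: "\<exists>j\<in>I. s j = S Z \<and> s j \<subseteq> Z" if "\<exists>j\<in>I. s j \<subseteq> Z" for Z
    using someI_ex[of "\<lambda>j. j \<in> I \<and> s j \<subseteq> Z"] that by (auto simp: S_def)
  have fins: "finite (s i)" if "i \<in> I" for i
    using s(1)[OF that] fin(1) by (rule finite_subset)
  have finS: "finite (S Z)" and cardS: "card (S Z) \<le> 2 * t" for Z
  proof -
    have "finite (S Z) \<and> card (S Z) \<le> 2 * t"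
    proof (cases "\<exists>j\<in>I. s j \<subseteq> Z")
      case True
      then show ?thesis using S[OF True] s(2) fins by metis
    qed (simp add: S_def)
    then show "finite (S Z)" "card (S Z) \<le> 2 * t" by auto
  qed
  define large where "large = (SIGMA U:Pow X. {i \<in> I. t \<le> card (?T U i)})"
  define codes where "codes = (SIGMA Z:Pow X. SIGMA T:{T. T \<subseteq> S Z \<and> t \<le> card T}. {i \<in> I. T \<subseteq> s i})"
  define h where "h = (\<lambda>(U, i). (U \<union> ?T U i, ?T U i, i))"
  \<comment> \<open>\<open>U = Z - T\<close> gives
    \<open>card (X - U) = card (X - Z) + card T\<close>, so \<open>w\<close> is the weight of the
    encoded pair.\<close>
  define w where "w = (\<lambda>(Z::'a set, T::'a set, i::'i). real q ^ card (X - Z) * real q ^ card T)"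
  have T: "?T U i \<subseteq> s i" "?T U i \<inter> U = {}" "?T U i \<subseteq> X" if "i \<in> I" for U i
    using fragment_subset[OF that, of s U] s(1)[OF that] by auto
  have inj: "inj_on h large"
  proof (rule inj_onI)
    fix a b assume ab: "a \<in> large" "b \<in> large" "h a = h b"
    obtain U i U' i' where eq: "a = (U, i)" "b = (U', i')" by (cases a, cases b)
    have "U \<union> ?T U i = U' \<union> ?T U' i'" "?T U i = ?T U' i'" "i = i'" "i \<in> I" "i' \<in> I"
      using ab by (auto simp: h_def eq large_def)
    then show "a = b" using T(2)[of i U] T(2)[of i' U'] by (auto simp: eq)
  qed
  have sub: "h ` large \<subseteq> codes"
  proof (clarsimp simp: h_def large_def codes_def, intro conjI)
    fix U i assume U: "U \<subseteq> X" and i: "i \<in> I" and card: "t \<le> card (?T U i)"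
    let ?Z = "U \<union> ?T U i"
    show "?T U i \<subseteq> X" "?T U i \<subseteq> s i" using T[OF i] by auto
    obtain j where j: "j \<in> I" "s j \<subseteq> s i \<union> U" "?T U i = s j - U"
      and least: "\<And>h. h \<in> I \<Longrightarrow> s h \<subseteq> s i \<union> U \<Longrightarrow> card (s j - U) \<le> card (s h - U)"
      using fragment_obtain[OF i] by blast
    have "\<exists>j\<in>I. s j \<subseteq> ?Z" using j by auto
    from S[OF this] obtain h where h: "h \<in> I" "s h = S ?Z" "s h \<subseteq> ?Z" by auto
    \<comment> \<open>\<open>s h\<close> competes in the minimisation that defines the fragment of
      \<open>i\<close>, and outside \<open>U\<close> it lies inside that fragment, so the two
      coincide there.\<close>
    have "card (s j - U) \<le> card (s h - U)"
      by (rule least) (use h T(1)[OF i] in auto)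
    moreover have "s h - U \<subseteq> s j - U" using h(3) j(3) by auto
    moreover have "finite (s j - U)" using fins[OF j(1)] by simp
    ultimately have "s h - U = s j - U" by (metis card_seteq)
    then show "?T U i \<subseteq> S ?Z" using j(3) h(2) by auto
  qed
  have fin_large: "finite large" unfolding large_def using fin by auto
  have fin_codes: "finite codes" unfolding codes_def using fin finS
    by (intro finite_SigmaI) auto
  have "(\<Sum>U\<in>Pow X. real q ^ card (X - U) * card {i \<in> I. t \<le> card (?T U i)})
      = (\<Sum>(U, i)\<in>large. real q ^ card (X - U))"
    unfolding large_def using fin by (subst sum.Sigma[symmetric]) (auto simp: mult.commute)
  also have "\<dots> = (\<Sum>a\<in>large. w (h a))"
  proof (rule sum.cong)
    fix a assume a: "a \<in> large"
    obtain U i where eq: "a = (U, i)" by (cases a)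
    have i: "i \<in> I" "U \<subseteq> X" using a by (auto simp: eq large_def)
    let ?Z = "U \<union> ?T U i"
    have "card (X - U) = card ((X - ?Z) \<union> ?T U i)"
      using T[OF i(1), of U] by (intro arg_cong[of _ _ card]) auto
    also have "\<dots> = card (X - ?Z) + card (?T U i)"
      using T(3)[OF i(1), of U] fin(1) by (intro card_Un_disjoint) (auto intro: finite_subset)
    finally have "card (X - U) = card (X - ?Z) + card (?T U i)" .
    then show "(case a of (U, i) \<Rightarrow> real q ^ card (X - U)) = w (h a)"
      by (simp add: eq w_def h_def power_add)
  qed simp
  also have "\<dots> = sum w (h ` large)" using inj by (simp add: sum.reindex)
  also have "\<dots> \<le> sum w codes"
    by (rule sum_mono2[OF fin_codes sub]) (auto simp: w_def)
  also have "\<dots> = (\<Sum>Z\<in>Pow X. real q ^ card (X - Z) *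
      (\<Sum>T | T \<subseteq> S Z \<and> t \<le> card T. real q ^ card T * card {i \<in> I. T \<subseteq> s i}))"
    unfolding codes_def w_def using fin finS
    apply (subst sum.Sigma[symmetric])
      apply simp
     apply (auto intro!: finite_SigmaI)[1]
    apply (subst sum.Sigma[symmetric])
      apply (auto simp: sum_distrib_left ac_simps)
    done
  also have "\<dots> \<le> (\<Sum>Z\<in>Pow X. real q ^ card (X - Z) * ((4 * q / D) ^ t * A))"
  proof (intro sum_mono mult_left_mono)
    fix Z assume "Z \<in> Pow X"
    have "real q ^ card T * card {i \<in> I. T \<subseteq> s i} \<le> (q / D) ^ t * A"
      if T: "T \<in> {T. T \<subseteq> S Z \<and> t \<le> card T}" for T
    proof -
      have "T \<noteq> {}" using T t by auto
      have "real q ^ card T * card {i \<in> I. T \<subseteq> s i}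
          = (q / D) ^ card T * (D ^ card T * card {i \<in> I. T \<subseteq> s i})"
        using D by (simp add: power_divide)
      also have "\<dots> \<le> (q / D) ^ card T * A"
        using spread[OF \<open>T \<noteq> {}\<close>] D by (intro mult_left_mono) auto
      also have "\<dots> \<le> (q / D) ^ t * A"
        using T D A by (intro mult_right_mono power_decreasing) auto
      finally show ?thesis .
    qed
    then have "(\<Sum>T | T \<subseteq> S Z \<and> t \<le> card T. real q ^ card T * card {i \<in> I. T \<subseteq> s i})
        \<le> card {T. T \<subseteq> S Z \<and> t \<le> card T} * ((q / D) ^ t * A)"
      by (rule sum_bounded_above)
    \<comment> \<open>\<open>S Z\<close> has at most \<open>2 * t\<close> elements, hence at most
      \<open>4 ^ t\<close> subsets: the source of the 4.\<close>
    also have "\<dots> \<le> 2 ^ (2 * t) * ((q / D) ^ t * A)"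
    proof (rule mult_right_mono)
      have "card {T. T \<subseteq> S Z \<and> t \<le> card T} \<le> card (Pow (S Z))"
        using finS by (intro card_mono) auto
      also have "\<dots> \<le> 2 ^ (2 * t)" using cardS by (simp add: card_Pow finS)
      finally show "real (card {T. T \<subseteq> S Z \<and> t \<le> card T}) \<le> 2 ^ (2 * t)"
        by (metis of_nat_le_iff of_nat_numeral of_nat_power)
    qed (use D A in auto)
    also have "\<dots> = (4 * q / D) ^ t * A"
      by (simp add: power_mult power_mult_distrib[symmetric])
    finally show "(\<Sum>T | T \<subseteq> S Z \<and> t \<le> card T. real q ^ card T * card {i \<in> I. T \<subseteq> s i})
        \<le> (4 * q / D) ^ t * A" .
  qed auto
  also have "\<dots> = (4 * q / D) ^ t * A * (real q + 1) ^ card X"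
    by (simp add: sum_distrib_right[symmetric] sum_Pow_power_card_Diff[OF fin(1)])
  finally show ?thesis .
qed

text \<open>Induction on the number of colours in \<open>J\<close>. Let \<open>U\<close> be the
  class of one colour of \<open>J\<close> and pass to the fragments. Those with at least
  \<open>2 ^ l\<close> elements are rare by the encoding; the others form a family that is still
  spread and has half the size bound, left to the remaining colours. The bound \<open>A\<close>
  stays fixed while the index set shrinks, which is why it is kept apart from
  \<open>card I\<close>.\<close>

lemma card_uncovered_colourings_le:
  fixes s :: "'i \<Rightarrow> 'a set" and C J :: "'c set" and D A :: real
  assumes "finite X" "finite I" "finite C" "J \<subseteq> C" "card J = l"
    and "\<And>i. i \<in> I \<Longrightarrow> s i \<subseteq> X" "\<And>i. i \<in> I \<Longrightarrow> card (s i) < 2 ^ l"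
    and "\<And>Z. Z \<noteq> {} \<Longrightarrow> D ^ card Z * card {i \<in> I. Z \<subseteq> s i} \<le> A"
    and "D > 0" "16 * card C \<le> D" "A \<ge> 0"
  shows "real (card {f \<in> X \<rightarrow>\<^sub>E C. \<forall>i\<in>I. \<not> f ` s i \<subseteq> J}) * card I
    \<le> (\<Sum>j=1..l. (1 / 4) ^ j) * A * real (card C) ^ card X"
  using assms
proof (induction l arbitrary: X I C J s)
  case 0
  then have "s i = {}" if "i \<in> I" for i
    using that by (metis card_0_eq finite_subset less_one power_0)
  then have "{f \<in> X \<rightarrow>\<^sub>E C. \<forall>i\<in>I. \<not> f ` s i \<subseteq> J} = {} \<or> I = {}" by auto
  then show ?case
  proof
    assume empty: "{f \<in> X \<rightarrow>\<^sub>E C. \<forall>i\<in>I. \<not> f ` s i \<subseteq> J} = {}"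
    show ?thesis unfolding empty by simp
  qed simp
next
  case (Suc l)
  note fin = Suc.prems(1-3) and sX = Suc.prems(6) and spread = Suc.prems(8)
  define t :: nat where "t = 2 ^ l"
  obtain c where c: "c \<in> J" using Suc.prems(5) by fastforce
  define C' J' where "C' = C - {c}" and "J' = J - {c}"
  have cC: "c \<in> C" using c Suc.prems(4) by auto
  have finJ: "finite J" using Suc.prems(3,4) finite_subset by blast
  have C': "finite C'" "J' \<subseteq> C'" "card J' = l" "card C = Suc (card C')"
    using Suc.prems(3-5) c cC finJ card_Suc_Diff1[OF finJ c] card_Suc_Diff1[OF fin(3) cC]
    by (auto simp: C'_def J'_def)
  let ?q = "card C'" and ?\<delta> = "\<Sum>j=1..l. (1 / 4 :: real) ^ j"
  define T where "T U = fragment I s U" for U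
  define I' where "I' U = {i \<in> I. card (T U i) < t}" for U
  define fail where "fail U = {g \<in> (X - U) \<rightarrow>\<^sub>E C'. \<forall>i\<in>I' U. \<not> g ` T U i \<subseteq> J'}" for U
  have fin_fail: "finite (fail U)" for U
    unfolding fail_def using fin C'(1)
    by (intro finite_subset[OF _ finite_PiE[of "X - U" "\<lambda>_. C'"]]) auto
  have T: "T U i \<subseteq> s i - U" if "i \<in> I" for U i
    using fragment_subset[OF that] by (simp add: T_def)
  have IH: "real (card (fail U)) * card (I' U) \<le> ?\<delta> * A * real ?q ^ card (X - U)" for U
    unfolding fail_def
  proof (rule Suc.IH)
    fix Z :: "'a set" assume Z: "Z \<noteq> {}"
    have "{i \<in> I' U. Z \<subseteq> T U i} \<subseteq> {i \<in> I. Z \<subseteq> s i}"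
      using T by (fastforce simp: I'_def)
    then have "card {i \<in> I' U. Z \<subseteq> T U i} \<le> card {i \<in> I. Z \<subseteq> s i}"
      using fin by (intro card_mono) auto
    then have "D ^ card Z * card {i \<in> I' U. Z \<subseteq> T U i} \<le> D ^ card Z * card {i \<in> I. Z \<subseteq> s i}"
      using \<open>D > 0\<close> by (intro mult_left_mono) auto
    also have "\<dots> \<le> A" using spread[OF Z] .
    finally show "D ^ card Z * card {i \<in> I' U. Z \<subseteq> T U i} \<le> A" .
  next
    show "finite (I' U)" using fin by (simp add: I'_def)
    show "T U i \<subseteq> X - U" if "i \<in> I' U" for i
      using that T[of i U] sX[of i] by (auto simp: I'_def)
    show "card (T U i) < 2 ^ l" if "i \<in> I' U" for i
      using that by (auto simp: I'_def t_def)
    show "real (16 * card C') \<le> D" using Suc.prems(10) C'(4) by simp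
  qed (use fin C' Suc.prems in auto)
  \<comment> \<open>Indices with a small fragment use the induction hypothesis; for the others the
    failing colourings are bounded by all colourings of \<open>X - U\<close>.\<close>
  have step: "real (card (fail U)) * card I \<le> ?\<delta> * A * real ?q ^ card (X - U)
      + real ?q ^ card (X - U) * card {i \<in> I. t \<le> card (T U i)}" for U
  proof -
    have "card I = card (I' U) + card {i \<in> I. t \<le> card (T U i)}"
      unfolding I'_def using fin
      by (subst card_Un_disjoint[symmetric]) (auto intro!: arg_cong[of _ _ card])
    then have "real (card (fail U)) * card I
        = real (card (fail U)) * card (I' U) + real (card (fail U)) * card {i \<in> I. t \<le> card (T U i)}"
      by (simp add: algebra_simps)
    moreover have "card (fail U) \<le> card ((X - U) \<rightarrow>\<^sub>E C')"
      unfolding fail_def using fin C' by (intro card_mono finite_PiE) auto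
    then have "real (card (fail U)) \<le> real ?q ^ card (X - U)"
      using fin by (simp add: card_PiE)
    ultimately show ?thesis using IH[of U] by (auto intro!: add_mono mult_right_mono)
  qed
  let ?F = "{f \<in> X \<rightarrow>\<^sub>E C. \<forall>i\<in>I. \<not> f ` s i \<subseteq> J}"
  define h where "h f = ({x \<in> X. f x = c}, restrict f {x \<in> X. f x \<noteq> c})" for f
  have "inj_on h ?F"
  proof (rule inj_onI)
    fix f g assume fg: "f \<in> ?F" "g \<in> ?F" "h f = h g"
    have eq: "{x \<in> X. f x = c} = {x \<in> X. g x = c}"
      "restrict f {x \<in> X. f x \<noteq> c} = restrict g {x \<in> X. g x \<noteq> c}"
      using fg(3) by (auto simp: h_def)
    show "f = g"
    proof (rule PiE_ext)
      show "f \<in> X \<rightarrow>\<^sub>E C" "g \<in> X \<rightarrow>\<^sub>E C" using fg by auto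
      fix x assume x: "x \<in> X"
      have c: "f x = c \<longleftrightarrow> g x = c" using eq(1) x by blast
      show "f x = g x"
      proof (cases "f x = c")
        case False
        then show ?thesis using fun_cong[OF eq(2), of x] c x by simp
      qed (use c in simp)
    qed
  qed
  moreover have "h ` ?F \<subseteq> Sigma (Pow X) fail"
  proof
    fix z assume "z \<in> h ` ?F"
    then obtain f where f: "f \<in> X \<rightarrow>\<^sub>E C" "\<And>i. i \<in> I \<Longrightarrow> \<not> f ` s i \<subseteq> J" "z = h f" by auto
    define U where "U = {x \<in> X. f x = c}"
    have XU: "{x \<in> X. f x \<noteq> c} = X - U" by (auto simp: U_def)
    \<comment> \<open>If \<open>J'\<close> covered the fragment \<open>s j - U\<close>, then
      \<open>J\<close> would cover \<open>s j\<close>, since \<open>U\<close> has colour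
      \<open>c\<close>. That \<open>j\<close> may differ from \<open>i\<close> is harmless, as
      \<open>f\<close> fails for every member.\<close>
    have "\<not> restrict f (X - U) ` T U i \<subseteq> J'" if i: "i \<in> I' U" for i
    proof
      assume sub: "restrict f (X - U) ` T U i \<subseteq> J'"
      have iI: "i \<in> I" using i by (simp add: I'_def)
      obtain j where j: "j \<in> I" "T U i = s j - U"
        using fragment_obtain[OF iI, of s U] by (metis T_def)
      have "f ` s j \<subseteq> J"
      proof
        fix y assume "y \<in> f ` s j"
        then obtain x where x: "x \<in> s j" "y = f x" by auto
        show "y \<in> J"
        proof (cases "x \<in> U")
          case True
          then show ?thesis using c x by (auto simp: U_def)
        next
          case False
          then have "x \<in> T U i" "x \<in> X - U" using x j sX by auto
          then have "f x \<in> J'" using sub by (auto simp: image_subset_iff)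
          then show ?thesis using x by (simp add: J'_def)
        qed
      qed
      with f(2)[OF j(1)] show False by simp
    qed
    moreover have "restrict f (X - U) \<in> (X - U) \<rightarrow>\<^sub>E C'"
      using f(1) by (auto simp: C'_def U_def)
    ultimately show "z \<in> Sigma (Pow X) fail"
      unfolding f(3) h_def XU fail_def by (auto simp: U_def)
  qed
  ultimately have "card ?F \<le> card (Sigma (Pow X) fail)"
    using fin fin_fail by (intro card_inj_on_le[of h]) auto
  also have "\<dots> = (\<Sum>U\<in>Pow X. card (fail U))" using fin fin_fail by simp
  finally have "real (card ?F) * card I \<le> (\<Sum>U\<in>Pow X. real (card (fail U))) * card I"
    by (intro mult_right_mono) (auto simp flip: of_nat_sum)
  also have "\<dots> \<le> (\<Sum>U\<in>Pow X. ?\<delta> * A * real ?q ^ card (X - U)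
      + real ?q ^ card (X - U) * card {i \<in> I. t \<le> card (T U i)})"
    by (subst sum_distrib_right) (intro sum_mono step)
  also have "\<dots> = ?\<delta> * A * real (card C) ^ card X
      + (\<Sum>U\<in>Pow X. real ?q ^ card (X - U) * card {i \<in> I. t \<le> card (T U i)})"
    using sum_Pow_power_card_Diff[OF fin(1), of "real ?q"] C'(4)
    by (simp add: sum.distrib sum_distrib_left[symmetric] add.commute)
  also have "\<dots> \<le> ?\<delta> * A * real (card C) ^ card X + (4 * ?q / D) ^ t * A * (real ?q + 1) ^ card X"
    unfolding T_def
    by (intro add_left_mono sum_large_fragments_le)
       (use Suc.prems C' in \<open>force simp: t_def intro: less_imp_le\<close>)+
  also have "(4 * ?q / D) ^ t * A * (real ?q + 1) ^ card X
      \<le> (1 / 4) ^ Suc l * A * real (card C) ^ card X"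
  proof -
    \<comment> \<open>\<open>16 * card C \<le> D\<close> makes the base at most 1/4; then
      \<open>t = 2 ^ l \<ge> l + 1\<close>.\<close>
    have "(4 * ?q / D) ^ t \<le> (1 / 4) ^ t"
      using Suc.prems(9,10) C'(4) by (intro power_mono) (auto simp: field_simps)
    also have "\<dots> \<le> (1 / 4 :: real) ^ Suc l"
      using less_exp[of l] by (intro power_decreasing) (auto simp: t_def Suc_le_eq)
    finally have "(4 * ?q / D) ^ t * A * (real ?q + 1) ^ card X
        \<le> (1 / 4) ^ Suc l * A * (real ?q + 1) ^ card X"
      using \<open>A \<ge> 0\<close> by (intro mult_right_mono) auto
    then show ?thesis using C'(4) by (simp add: add.commute)
  qed
  finally show ?case by (simp add: algebra_simps)
qed

lemma sum_quarter_powers_le: "(\<Sum>j=1..l. (1 / 4) ^ j) \<le> (1 / 2 :: real)"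
proof -
  have "3 * (\<Sum>j=1..l. (1 / 4) ^ j) + (1 / 4 :: real) ^ l = 1"
    by (induction l) (simp_all add: algebra_simps)
  moreover have "(1 / 4 :: real) ^ l \<ge> 0" by simp
  ultimately show ?thesis by linarith
qed

text \<open>
  Colour the ground set with \<open>2 r\<close> groups of \<open>l\<close> colours each. On average at least half of the
  groups contain a member of the family, and members in different groups are disjoint.
\<close>

lemma spread_imp_disjoint_members:
  fixes s :: "'i \<Rightarrow> 'a set" and D :: real and r l :: nat
  assumes fin: "finite X" "finite I" "I \<noteq> {}" "l > 0"
    and s: "\<And>i. i \<in> I \<Longrightarrow> s i \<subseteq> X" "\<And>i. i \<in> I \<Longrightarrow> card (s i) < 2 ^ l"
    and spread: "\<And>Z. Z \<noteq> {} \<Longrightarrow> D ^ card Z * card {i \<in> I. Z \<subseteq> s i} \<le> card I"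
    and D: "D > 0" "32 * r * l \<le> D"
  shows "\<exists>g. (\<forall>m<r. g m \<in> I) \<and> (\<forall>m<r. \<forall>m'<r. m \<noteq> m' \<longrightarrow> s (g m) \<inter> s (g m') = {})"
proof (cases "r = 0")
  case False
  \<comment> \<open>With \<open>2 * r * l\<close> colours in all, the requirement
    \<open>16 * card C \<le> D\<close> becomes \<open>32 * r * l \<le> D\<close>.\<close>
  define C where "C = {..<2 * r} \<times> {..<l}"
  define J where "J m = {m} \<times> {..<l}" for m :: nat
  have C: "finite C" "card C = 2 * r * l" by (auto simp: C_def)
  define good where "good m = {f \<in> X \<rightarrow>\<^sub>E C. \<exists>i\<in>I. f ` s i \<subseteq> J m}" for m
  let ?N = "card (X \<rightarrow>\<^sub>E C)"
  have finP: "finite (X \<rightarrow>\<^sub>E C)" using fin C by (auto intro: finite_PiE)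
  have half: "real ?N / 2 \<le> card (good m)" if m: "m < 2 * r" for m
  proof -
    let ?F = "{f \<in> X \<rightarrow>\<^sub>E C. \<forall>i\<in>I. \<not> f ` s i \<subseteq> J m}"
    have "real (card ?F) * card I \<le> (\<Sum>j=1..l. (1 / 4) ^ j) * card I * real (card C) ^ card X"
      by (rule card_uncovered_colourings_le[where D = D])
         (use assms C m in \<open>auto simp: J_def C_def\<close>)
    also have "\<dots> \<le> 1 / 2 * card I * real (card C) ^ card X"
      by (intro mult_right_mono sum_quarter_powers_le) auto
    finally have "real (card ?F) \<le> real ?N / 2"
      using fin by (simp add: card_PiE field_simps card_gt_0_iff)
    moreover have "?N = card (good m) + card ?F"
      unfolding good_def using finP
      by (subst card_Un_disjoint[symmetric]) (auto intro!: arg_cong[of _ _ card])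
    ultimately show ?thesis by simp
  qed
  have "\<exists>f\<in>X \<rightarrow>\<^sub>E C. r \<le> card {m \<in> {..<2 * r}. f \<in> good m}"
  proof (rule ccontr)
    assume "\<not> ?thesis"
    then have less: "card {m \<in> {..<2 * r}. f \<in> good m} < r" if "f \<in> X \<rightarrow>\<^sub>E C" for f
      using that by (meson not_le)
    have gsub: "{f \<in> X \<rightarrow>\<^sub>E C. f \<in> good m} = good m" for m by (auto simp: good_def)
    have "C \<noteq> {}" using False \<open>l > 0\<close> by (auto simp: C_def lessThan_empty_iff)
    then have "?N \<noteq> 0" using fin C(1) by (simp add: card_PiE)
    then have ne: "X \<rightarrow>\<^sub>E C \<noteq> {}" by auto
    have "real r * ?N \<le> (\<Sum>m<2 * r. real (card (good m)))"
      using sum_mono[of "{..<2 * r}" "\<lambda>_. real ?N / 2" "\<lambda>m. real (card (good m))"] half by simp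
    also have "\<dots> = real (\<Sum>f\<in>X \<rightarrow>\<^sub>E C. card {m \<in> {..<2 * r}. f \<in> good m})"
      using sum_multicount_gen[OF finP, of "{..<2 * r}" "\<lambda>f m. f \<in> good m" "\<lambda>m. card (good m)"] gsub
      by simp
    also have "\<dots> < real (\<Sum>f\<in>X \<rightarrow>\<^sub>E C. r)"
      using finP ne less by (intro of_nat_less_iff[THEN iffD2] sum_strict_mono) auto
    finally show False by (simp add: mult.commute)
  qed
  then obtain f where f: "r \<le> card {m \<in> {..<2 * r}. f \<in> good m}" by blast
  then obtain M where M: "M \<subseteq> {m \<in> {..<2 * r}. f \<in> good m}" "card M = r"
    by (meson obtain_subset_with_card_n)
  have "finite M" by (rule finite_subset[OF M(1)]) simp
  then obtain e where e: "bij_betw e {..<r} M"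
    using ex_bij_betw_nat_finite[of M] M(2) by (auto simp: atLeast0LessThan)
  have "\<forall>m\<in>M. \<exists>i\<in>I. f ` s i \<subseteq> J m" using M by (auto simp: good_def)
  then obtain i where i: "\<And>m. m \<in> M \<Longrightarrow> i m \<in> I \<and> f ` s (i m) \<subseteq> J m" by metis
  have eM: "e m \<in> M" if "m < r" for m using e that by (auto simp: bij_betw_def)
  have "s (i (e m)) \<inter> s (i (e m')) = {}" if "m < r" "m' < r" "m \<noteq> m'" for m m'
  proof -
    have "e m \<noteq> e m'" using e that by (auto simp: bij_betw_def inj_on_def)
    then have "J (e m) \<inter> J (e m') = {}" by (auto simp: J_def)
    then show ?thesis using i[OF eM[OF that(1)]] i[OF eM[OF that(2)]] by blast
  qed
  then show ?thesis using i eM by (intro exI[of _ "\<lambda>m. i (e m)"]) auto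
qed auto

text \<open>Take a largest \<open>K\<close> contained in more than \<open>D ^ (N - card K)\<close>
  members. By maximality the sets \<open>S - K\<close>, for members \<open>S\<close> containing
  \<open>K\<close>, are spread, so \<open>r\<close> of them are pairwise disjoint; adding
  \<open>K\<close> back gives the sunflower. Proper containment keeps the petals nonempty.\<close>

lemma exists_sunflower:
  fixes \<F> :: "'a set set" and N r l :: nat
  assumes fin: "finite \<F>" and card: "\<And>S. S \<in> \<F> \<Longrightarrow> finite S \<and> card S = N"
    and "N < 2 ^ l" "r > 0" and large: "(32 * r * l) ^ N < card \<F>"
  obtains K g where "\<And>m. m < r \<Longrightarrow> g m \<in> \<F>" "\<And>m. m < r \<Longrightarrow> K \<subset> g m"
    "\<And>m m'. m < r \<Longrightarrow> m' < r \<Longrightarrow> m \<noteq> m' \<Longrightarrow> g m \<inter> g m' = K"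
proof -
  define D where "D = 32 * r * l"
  define P where "P d \<longleftrightarrow> (\<exists>K. finite K \<and> card K = d \<and> D ^ (N - d) < card {S \<in> \<F>. K \<subseteq> S})" for d
  have "P 0" unfolding P_def using large by (intro exI[of _ "{}"]) (auto simp: D_def)
  have less: "d < N" if d: "P d" for d
  proof -
    obtain K where K: "finite K" "card K = d" "D ^ (N - d) < card {S \<in> \<F>. K \<subseteq> S}"
      using d by (auto simp: P_def)
    then have "card {S \<in> \<F>. K \<subseteq> S} > 0" by linarith
    then obtain S where S: "S \<in> \<F>" "K \<subseteq> S" by (auto simp: card_gt_0_iff)
    have "d \<le> N" using card[OF S(1)] S(2) K(2) card_mono by blast
    \<comment> \<open>For \<open>d = N\<close> the only member that can contain \<open>K\<close> is
      \<open>K\<close> itself, but there must be more than \<open>D ^ 0 = 1\<close>.\<close>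
    moreover have "d \<noteq> N"
    proof
      assume "d = N"
      have "S = K" if "S \<in> \<F>" "K \<subseteq> S" for S
        using card_subset_eq[of S K] card[OF that(1)] that(2) K(2) \<open>d = N\<close> by simp
      then have "{S \<in> \<F>. K \<subseteq> S} \<subseteq> {K}" by auto
      then have "card {S \<in> \<F>. K \<subseteq> S} \<le> 1" using card_mono[of "{K}"] by simp
      with K(3) \<open>d = N\<close> show False by simp
    qed
    ultimately show ?thesis by simp
  qed
  define d where "d = Greatest P"
  have bound: "\<forall>d'. P d' \<longrightarrow> d' \<le> N" using less less_imp_le by blast
  have "P d" unfolding d_def by (rule GreatestI_nat[where P = P, OF \<open>P 0\<close>]) (use bound in blast)
  have max: "d' \<le> d" if "P d'" for d'
    unfolding d_def by (rule Greatest_le_nat[where P = P, OF that]) (use bound in blast)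
  from \<open>P d\<close> obtain K where K: "finite K" "card K = d" "D ^ (N - d) < card {S \<in> \<F>. K \<subseteq> S}"
    by (auto simp: P_def)
  have "d < N" using less \<open>P d\<close> .
  then have l: "l > 0" using \<open>N < 2 ^ l\<close> by (cases l) auto
  define I where "I = {S \<in> \<F>. K \<subseteq> S}"
  have "\<exists>g. (\<forall>m<r. g m \<in> I) \<and> (\<forall>m<r. \<forall>m'<r. m \<noteq> m' \<longrightarrow> (g m - K) \<inter> (g m' - K) = {})"
  proof (rule spread_imp_disjoint_members[where X = "\<Union>\<F>" and l = l and D = "real D"])
    fix Z :: "'a set" assume "Z \<noteq> {}"
    show "real D ^ card Z * card {S \<in> I. Z \<subseteq> S - K} \<le> card I"
    proof (cases "finite Z \<and> Z \<inter> K = {} \<and> d + card Z \<le> N")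
      case True
      then have c: "card (K \<union> Z) = d + card Z" using K by (simp add: card_Un_disjoint Int_commute)
      have "card Z > 0" using True \<open>Z \<noteq> {}\<close> by (simp add: card_gt_0_iff)
      then have "\<not> P (d + card Z)" using max[of "d + card Z"] by auto
      then have "card {S \<in> \<F>. K \<union> Z \<subseteq> S} \<le> D ^ (N - (d + card Z))"
        using True K(1) c unfolding P_def by (meson finite_UnI not_le)
      moreover have "{S \<in> I. Z \<subseteq> S - K} = {S \<in> \<F>. K \<union> Z \<subseteq> S}" using True by (auto simp: I_def)
      ultimately have "D ^ card Z * card {S \<in> I. Z \<subseteq> S - K} \<le> D ^ card Z * D ^ (N - (d + card Z))"
        by simp
      also have "\<dots> = D ^ (N - d)" using True by (simp flip: power_add)
      also have "\<dots> \<le> card I" using K(3) by (simp add: I_def)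
      finally show ?thesis by (metis of_nat_le_iff of_nat_mult of_nat_power)
    next
      case False
      have "{S \<in> I. Z \<subseteq> S - K} = {}"
      proof (rule ccontr)
        assume "{S \<in> I. Z \<subseteq> S - K} \<noteq> {}"
        then obtain S where S: "S \<in> \<F>" "K \<subseteq> S" "Z \<subseteq> S - K" by (auto simp: I_def)
        have "finite Z" using S card[OF S(1)] finite_subset by blast
        moreover have "Z \<inter> K = {}" using S by auto
        moreover have "card (K \<union> Z) \<le> N" using S card[OF S(1)] by (metis Diff_subset Un_least card_mono order_trans)
        ultimately show False using False K by (simp add: card_Un_disjoint Int_commute)
      qed
      then show ?thesis by (metis card.empty mult_zero_right of_nat_0 of_nat_0_le_iff)
    qed
  next
    show "finite (\<Union>\<F>)" "finite I" using fin card by (auto simp: I_def)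
    have "card I > 0" using K(3) by (simp add: I_def)
    then show "I \<noteq> {}" by auto
    show "S - K \<subseteq> \<Union>\<F>" if "S \<in> I" for S using that by (auto simp: I_def)
    show "card (S - K) < 2 ^ l" if "S \<in> I" for S
      using that card[of S] \<open>N < 2 ^ l\<close> card_mono[of S "S - K"] by (auto simp: I_def)
    show "real D > 0" "real (32 * r * l) \<le> real D" using \<open>r > 0\<close> l by (auto simp: D_def)
  qed (rule l)
  then obtain g where g: "\<And>m. m < r \<Longrightarrow> g m \<in> I"
    "\<And>m m'. m < r \<Longrightarrow> m' < r \<Longrightarrow> m \<noteq> m' \<Longrightarrow> (g m - K) \<inter> (g m' - K) = {}" by blast
  show ?thesis
  proof (rule that[of g K])
    fix m assume m: "m < r"
    show "g m \<in> \<F>" using g(1)[OF m] by (simp add: I_def)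
    then have "card (g m) = N" using card by auto
    then have "K \<noteq> g m" using K(2) \<open>d < N\<close> by auto
    then show "K \<subset> g m" using g(1)[OF m] by (auto simp: I_def)
  next
    fix m m' assume "m < r" "m' < r" "m \<noteq> m'"
    then show "g m \<inter> g m' = K" using g(1)[of m] g(1)[of m'] g(2)[of m m'] by (auto simp: I_def)
  qed
qed

section \<open>Matchings covering a common vertex set\<close>

definition matchings :: "'a set set \<Rightarrow> nat \<Rightarrow> 'a set set set" where
  "matchings E j = {M. M \<subseteq> E \<and> card M = j \<and> pairwise disjnt M}"

lemma finite_matchings: "finite E \<Longrightarrow> finite (matchings E j)"
  unfolding matchings_def by (rule finite_subset[of _ "Pow E"]) auto

text \<open>A matching of \<open>j\<close> edges covers at most \<open>j * k\<close> vertices, which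
  meet at most half of the edges, so at least \<open>card E / 2\<close> edges extend it. Count the
  pairs of a matching and an added edge: a matching of \<open>j + 1\<close> edges arises from at
  most \<open>j + 1\<close> of them.\<close>

lemma matchings_Suc_ge:
  assumes fin: "finite E" and E: "\<And>e. e \<in> E \<Longrightarrow> finite e \<and> card e = k" and "k > 0"
    and deg: "\<And>v. hypergraph_degree E v \<le> \<Delta>" and j: "2 * j * k * \<Delta> \<le> card E"
  shows "card (matchings E j) * card E \<le> 2 * Suc j * card (matchings E (Suc j))"
proof -
  define ext where "ext M = {e \<in> E. e \<inter> \<Union>M = {}}" for M
  have ext: "card E \<le> 2 * card (ext M)" if M: "M \<in> matchings E j" for M
  proof -
    have finM: "finite M" using M fin finite_subset by (auto simp: matchings_def)
    have "card (\<Union>M) \<le> (\<Sum>e\<in>M. card e)" by (rule card_Union_le_sum_card)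
    also have "\<dots> = j * k" using M E by (subst sum.cong[of M M card "\<lambda>_. k"]) (auto simp: matchings_def)
    finally have cU: "card (\<Union>M) \<le> j * k" .
    have finU: "finite (\<Union>M)" using M E finM by (auto simp: matchings_def)
    have "E \<subseteq> ext M \<union> (\<Union>v\<in>\<Union>M. {e \<in> E. v \<in> e})" by (auto simp: ext_def)
    moreover have "finite (ext M \<union> (\<Union>v\<in>\<Union>M. {e \<in> E. v \<in> e}))"
      using fin by (rule finite_subset[rotated]) (auto simp: ext_def)
    ultimately have "card E \<le> card (ext M \<union> (\<Union>v\<in>\<Union>M. {e \<in> E. v \<in> e}))"
      by (metis card_mono)
    also have "\<dots> \<le> card (ext M) + card (\<Union>v\<in>\<Union>M. {e \<in> E. v \<in> e})" by (rule card_Un_le)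
    also have "card (\<Union>v\<in>\<Union>M. {e \<in> E. v \<in> e}) \<le> (\<Sum>v\<in>\<Union>M. hypergraph_degree E v)"
      unfolding hypergraph_degree_def by (rule card_UN_le[OF finU])
    also have "\<dots> \<le> card (\<Union>M) * \<Delta>" using sum_bounded_above[of "\<Union>M" _ \<Delta>] deg by simp
    also have "\<dots> \<le> j * k * \<Delta>" using cU by simp
    finally show ?thesis using j by simp
  qed
  define h where "h = (\<lambda>(M, e). (insert e M, e :: 'a set))"
  have notin: "e \<notin> M" if "e \<in> ext M" for e M
  proof
    assume "e \<in> M"
    then have "e = {}" using that by (auto simp: ext_def)
    then show False using that E[of e] \<open>k > 0\<close> by (auto simp: ext_def)
  qed
  have "inj_on h (SIGMA M:matchings E j. ext M)"
  proof (rule inj_onI, clarsimp simp: h_def)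
    fix M M' e assume "e \<in> ext M" "e \<in> ext M'" "insert e M = insert e M'"
    then show "M = M'" using notin by (metis insert_ident)
  qed
  moreover have "h ` (SIGMA M:matchings E j. ext M) \<subseteq> (SIGMA M:matchings E (Suc j). M)"
  proof (clarsimp simp: h_def)
    fix M e assume M: "M \<in> matchings E j" and e: "e \<in> ext M"
    have "finite M" using M fin finite_subset by (auto simp: matchings_def)
    then show "insert e M \<in> matchings E (Suc j)" using M e notin[OF e]
      by (auto simp: matchings_def ext_def pairwise_insert disjnt_def)
  qed
  moreover have "finite M" if "M \<in> matchings E (Suc j)" for M
    using that fin finite_subset by (auto simp: matchings_def)
  ultimately have "card (SIGMA M:matchings E j. ext M) \<le> card (SIGMA M:matchings E (Suc j). M)"
    using finite_matchings[OF fin] by (intro card_inj_on_le[of h]) auto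
  also have "\<dots> = (\<Sum>M\<in>matchings E (Suc j). card M)"
    using finite_matchings[OF fin] fin
    by (intro card_SigmaI) (auto simp: matchings_def intro: finite_subset)
  also have "\<dots> = Suc j * card (matchings E (Suc j))" by (simp add: matchings_def)
  finally have "(\<Sum>M\<in>matchings E j. card (ext M)) \<le> Suc j * card (matchings E (Suc j))"
    using finite_matchings[OF fin] fin by (subst (asm) card_SigmaI) (auto simp: ext_def)
  moreover have "card (matchings E j) * card E \<le> (\<Sum>M\<in>matchings E j. 2 * card (ext M))"
    using sum_bounded_below[of "matchings E j" "card E" "\<lambda>M. 2 * card (ext M)"] ext by simp
  ultimately show ?thesis by (simp flip: sum_distrib_left)
qed

text \<open>Iterates the extension count; the factorial appears because matchings are unordered.
  With \<open>fact N \<le> N ^ N\<close> it gives at least \<open>(card E / (2 * N)) ^ N\<close>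
  matchings.\<close>

lemma power_card_le_matchings:
  assumes fin: "finite E" and E: "\<And>e. e \<in> E \<Longrightarrow> finite e \<and> card e = k" and "k > 0"
    and deg: "\<And>v. hypergraph_degree E v \<le> \<Delta>" and N: "2 * N * k * \<Delta> \<le> card E"
  shows "card E ^ N \<le> 2 ^ N * fact N * card (matchings E N)"
  using N
proof (induction N)
  case 0
  have "M = {}" if "M \<subseteq> E" "card M = 0" for M
    using that fin by (simp add: finite_subset)
  then have "matchings E 0 = {{}}" by (auto simp: matchings_def)
  then show ?case by simp
next
  case (Suc N)
  have N: "2 * N * k * \<Delta> \<le> card E" using Suc.prems by (simp add: algebra_simps)
  have "card E ^ Suc N \<le> 2 ^ N * fact N * (card (matchings E N) * card E)"
    using Suc.IH[OF N] by (simp add: mult.commute mult.left_commute)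
  also have "\<dots> \<le> 2 ^ N * fact N * (2 * Suc N * card (matchings E (Suc N)))"
    by (intro mult_left_mono matchings_Suc_ge[OF fin E \<open>k > 0\<close> deg N]) auto
  also have "\<dots> = 2 ^ Suc N * fact (Suc N) * card (matchings E (Suc N))"
    by (simp add: algebra_simps)
  finally show ?case .
qed

text \<open>
  By pigeonhole many matchings cover the same vertex set. Removing the kernel from a sunflower of
  such matchings leaves disjoint perfect matchings of a common vertex set.
\<close>

lemma regular_subhypergraph_of_many_matchings:
  assumes "finite V" and E: "\<And>e. e \<in> E \<Longrightarrow> e \<subseteq> V \<and> card e = k \<and> e \<inter> A \<noteq> {}"
    and "A \<subseteq> V" "k > 0" "r > 0" "N < 2 ^ l"
    and many: "(32 * r * l) ^ N * ((card A choose N) * (card V choose ((k - 1) * N)))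
      < card (matchings E N)"
  shows "\<exists>W F. subhypergraph W F E \<and> regular_hypergraph r W F"
proof -
  have finE: "finite E" using E \<open>finite V\<close> by (intro finite_subset[of E "Pow V"]) auto
  have finA: "finite A" using assms finite_subset by blast
  have "\<forall>e\<in>E. \<exists>v. v \<in> e \<inter> A" using E by blast
  then obtain a where a: "\<And>e. e \<in> E \<Longrightarrow> a e \<in> e \<inter> A" by metis
  define B where "B = {P. P \<subseteq> A \<and> card P = N} \<times> {Q. Q \<subseteq> V \<and> card Q = (k - 1) * N}"
  \<comment> \<open>The chosen vertices are recorded apart from the others: they lie in
    \<open>A\<close>, so they cost \<open>card A choose N\<close> instead of a choice from all of
    \<open>V\<close>. The pair still determines the covered set.\<close>
  define \<phi> where "\<phi> M = (a ` M, \<Union>M - a ` M)" for M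
  have cardB: "card B = (card A choose N) * (card V choose ((k - 1) * N))"
    by (simp add: B_def card_cartesian_product n_subsets finA \<open>finite V\<close>)
  have \<phi>: "\<phi> M \<in> B" if M: "M \<in> matchings E N" for M
  proof -
    have M': "M \<subseteq> E" "card M = N" "pairwise disjnt M" using M by (auto simp: matchings_def)
    have finM: "finite M" using M'(1) finE finite_subset by blast
    have "inj_on a M"
    proof (rule inj_onI)
      fix e f assume ef: "e \<in> M" "f \<in> M" "a e = a f"
      then have "a e \<in> e \<inter> f" using a[of e] a[of f] M'(1) by auto
      then show "e = f" using ef pairwiseD[OF M'(3), of e f] by (auto simp: disjnt_def)
    qed
    then have c1: "card (a ` M) = N" using M'(2) by (simp add: card_image)
    have "card (\<Union>M) = (\<Sum>e\<in>M. card e)"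
    proof (rule card_Union_disjoint)
      show "finite e" if "e \<in> M" for e
        using that M'(1) E[of e] \<open>finite V\<close> finite_subset by blast
    qed (rule M'(3))
    also have "\<dots> = k * N" using M' E by (subst sum.cong[of M M card "\<lambda>_. k"]) auto
    finally have "card (\<Union>M) = k * N" .
    moreover have sub: "a ` M \<subseteq> \<Union>M" using a M'(1) by auto
    ultimately have "card (\<Union>M - a ` M) = (k - 1) * N"
      using c1 finM by (simp add: card_Diff_subset diff_mult_distrib)
    moreover have "\<Union>M \<subseteq> V" using M' E by auto
    moreover have "a ` M \<subseteq> A" using a M'(1) by auto
    ultimately show ?thesis using c1 by (auto simp: B_def \<phi>_def)
  qed
  have "matchings E N \<noteq> {}" using many by auto
  then have "B \<noteq> {}" using \<phi> by auto
  moreover have "finite B" unfolding B_def using finA \<open>finite V\<close> by simp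
  ultimately obtain y where y: "card (matchings E N) \<le> card (\<phi> -` {y} \<inter> matchings E N) * card B"
    using pigeonhole_card[of \<phi> "matchings E N" B] \<phi> finite_matchings[OF finE] by auto
  define \<F> where "\<F> = \<phi> -` {y} \<inter> matchings E N"
  have "(32 * r * l) ^ N * card B < card \<F> * card B" 
    using less_le_trans[OF many[folded cardB] y] by (simp only: \<F>_def)
  then have large: "(32 * r * l) ^ N < card \<F>" by simp
  have cover: "\<Union>M = fst y \<union> snd y" if "M \<in> \<F>" for M
  proof -
    have "M \<subseteq> E" "y = (a ` M, \<Union>M - a ` M)" using that by (auto simp: \<F>_def \<phi>_def matchings_def)
    then show ?thesis using a by auto
  qed
  have \<F>: "M \<subseteq> E" "card M = N" "pairwise disjnt M" if "M \<in> \<F>" for M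
    using that by (auto simp: \<F>_def matchings_def)
  have "finite \<F>" using finite_matchings[OF finE] by (simp add: \<F>_def)
  moreover have "finite M \<and> card M = N" if "M \<in> \<F>" for M
    using \<F>[OF that] finE finite_subset by auto
  ultimately obtain K g where g: "\<And>m. m < r \<Longrightarrow> g m \<in> \<F>" "\<And>m. m < r \<Longrightarrow> K \<subset> g m"
    "\<And>m m'. m < r \<Longrightarrow> m' < r \<Longrightarrow> m \<noteq> m' \<Longrightarrow> g m \<inter> g m' = K"
    using exists_sunflower[OF _ _ \<open>N < 2 ^ l\<close> \<open>r > 0\<close> large] by metis
  define F where "F = (\<Union>m<r. g m - K)"
  have FE: "F \<subseteq> E" using g(1) \<F>(1) by (fastforce simp: F_def)
  have disj: "e = f" if "m < r" "e \<in> g m" "f \<in> g m" "v \<in> e" "v \<in> f" for m e f v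
    using pairwiseD[OF \<F>(3)[OF g(1)[OF that(1)]], of e f] that(2-) by (auto simp: disjnt_def)
  have "hypergraph_degree F v = r" if v: "v \<in> \<Union>F" for v
  proof -
    obtain e m0 where e: "v \<in> e" "e \<in> g m0" "e \<notin> K" "m0 < r" using v by (auto simp: F_def)
    \<comment> \<open>An edge of \<open>K\<close> through \<open>v\<close> would belong to
      \<open>g m0\<close> together with \<open>e\<close>; disjointness forces it to equal
      \<open>e\<close>, which is outside \<open>K\<close>.\<close>
    have vK: "f \<notin> K" if "v \<in> f" for f
      using disj[OF e(4,2) _ e(1) that] g(2)[OF e(4)] e(3) by auto
    have "\<exists>f\<in>g m. v \<in> f" if m: "m < r" for m
    proof -
      have "v \<in> \<Union>(g m)" using cover[OF g(1)[OF m]] cover[OF g(1)[OF e(4)]] e by auto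
      then show ?thesis by auto
    qed
    then obtain f where f: "\<And>m. m < r \<Longrightarrow> f m \<in> g m \<and> v \<in> f m" by metis
    \<comment> \<open>Each of the \<open>r\<close> matchings contributes its only edge through
      \<open>v\<close>, and these edges differ because a common edge would lie in
      \<open>K\<close>.\<close>
    have "{e \<in> F. v \<in> e} = f ` {..<r}"
    proof (intro equalityI subsetI)
      fix e' assume "e' \<in> {e \<in> F. v \<in> e}"
      then obtain m where m: "m < r" "e' \<in> g m" "v \<in> e'" by (auto simp: F_def)
      then have "e' = f m" using disj f by blast
      then show "e' \<in> f ` {..<r}" using m by auto
    next
      fix e' assume "e' \<in> f ` {..<r}"
      then show "e' \<in> {e \<in> F. v \<in> e}" using f vK by (auto simp: F_def)
    qed
    moreover have "inj_on f {..<r}"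
    proof (rule inj_onI, rule ccontr)
      fix m m' assume mm: "m \<in> {..<r}" "m' \<in> {..<r}" "f m = f m'" "m \<noteq> m'"
      then have "f m \<in> g m \<inter> g m'" using f by (metis IntI lessThan_iff)
      then show False using g(3)[of m m'] mm f vK by auto
    qed
    ultimately show ?thesis by (simp add: hypergraph_degree_def card_image)
  qed
  moreover have "\<Union>F \<noteq> {}"
  proof -
    obtain e where e: "e \<in> g 0 - K" using g(2)[OF \<open>r > 0\<close>] by auto
    then have "e \<in> F" using \<open>r > 0\<close> by (auto simp: F_def)
    moreover have "e \<noteq> {}" using FE E \<open>e \<in> F\<close> \<open>k > 0\<close> by fastforce
    ultimately show ?thesis by auto
  qed
  ultimately show ?thesis using FE
    by (intro exI[of _ "\<Union>F"] exI[of _ F]) (auto simp: subhypergraph_def regular_hypergraph_def)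
qed

section \<open>Degrees and dyadic regularisation\<close>

lemma sum_hypergraph_degree:
  assumes "finite V" and E: "\<And>e. e \<in> E \<Longrightarrow> e \<subseteq> V \<and> card e = k"
  shows "(\<Sum>v\<in>V. hypergraph_degree E v) = k * card E"
  unfolding hypergraph_degree_def
proof (rule sum_multicount)
  show "finite E" using assms by (intro finite_subset[of E "Pow V"]) auto
  have "{v \<in> V. v \<in> e} = e" if "e \<in> E" for e using E[OF that] by auto
  then show "\<forall>e\<in>E. card {v \<in> V. v \<in> e} = k" using E by simp
qed (rule assms(1))

text \<open>Pick a second vertex from every edge through \<open>v\<close>, possible as
  \<open>k \<ge> 2\<close>. Two such edges already share \<open>v\<close>, so linearity makes the
  picks distinct.\<close>

lemma linear_hypergraph_degree_le:
  assumes "finite V" and E: "\<And>e. e \<in> E \<Longrightarrow> e \<subseteq> V \<and> card e = k" and "k \<ge> 2"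
    and lin: "linear_hypergraph E"
  shows "hypergraph_degree E v \<le> card V"
proof -
  have fin: "finite e" if "e \<in> E" for e using E[OF that] assms(1) finite_subset by blast
  have "\<exists>w\<in>e. w \<noteq> v" if "e \<in> E" for e
  proof (rule ccontr)
    assume "\<not> ?thesis"
    then have "e \<subseteq> {v}" by auto
    then have "card e \<le> 1" using card_mono[of "{v}" e] by simp
    then show False using E[OF that] \<open>k \<ge> 2\<close> by simp
  qed
  then obtain w where w: "\<And>e. e \<in> E \<Longrightarrow> w e \<in> e \<and> w e \<noteq> v" by metis
  show ?thesis
    unfolding hypergraph_degree_def
  proof (rule card_inj_on_le[of w])
    show "inj_on w {e \<in> E. v \<in> e}"
    proof (rule inj_onI, rule ccontr)
      fix e f assume ef: "e \<in> {e \<in> E. v \<in> e}" "f \<in> {e \<in> E. v \<in> e}" "w e = w f" "e \<noteq> f"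
      then have "{v, w e} \<subseteq> e \<inter> f" using w[of e] w[of f] by auto
      then have "card {v, w e} \<le> card (e \<inter> f)" using fin[of e] ef by (intro card_mono) auto
      moreover have "card (e \<inter> f) \<le> 1" using lin ef by (simp add: linear_hypergraph_def)
      moreover have "v \<noteq> w e" using w[of e] ef by auto
      ultimately show False by simp
    qed
    show "w ` {e \<in> E. v \<in> e} \<subseteq> V" using w E by blast
  qed (rule assms(1))
qed

text \<open>
  Edges are grouped by the dyadic size of their largest degree, so only one factor \<open>B\<close> is lost.
\<close>

lemma obtain_dyadic_class:
  assumes "finite E" and ne: "\<And>e. e \<in> E \<Longrightarrow> e \<noteq> {}" and "B > 0"
    and deg: "\<And>v. hypergraph_degree E v < 2 ^ B"
  obtains a E' where "E' \<subseteq> E" "card E \<le> B * card E'" "a < B"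
    "\<And>e. e \<in> E' \<Longrightarrow> \<exists>v\<in>e. 2 ^ a \<le> hypergraph_degree E v"
    "\<And>v. hypergraph_degree E' v \<le> 2 ^ Suc a"
proof -
  \<comment> \<open>Degrees are taken in \<open>E\<close>. Passing to a class only lowers them, so
    the upper bound carries over to the class, while the lower bound remains one on degrees in
    \<open>E\<close>.\<close>
  define cls where "cls a = {e \<in> E. (\<exists>v\<in>e. 2 ^ a \<le> hypergraph_degree E v) \<and>
    (\<forall>v\<in>e. hypergraph_degree E v < 2 ^ Suc a)}" for a
  have "E \<subseteq> (\<Union>a<B. cls a)"
  proof
    fix e assume e: "e \<in> E"
    let ?P = "\<lambda>a. \<exists>v\<in>e. 2 ^ a \<le> hypergraph_degree E v"
    have bound: "a \<le> B" if Pa: "?P a" for a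
    proof (rule ccontr)
      assume "\<not> a \<le> B"
      then have "(2::nat) ^ B \<le> 2 ^ a" by (intro power_increasing) auto
      moreover obtain v where "2 ^ a \<le> hypergraph_degree E v" using Pa by auto
      ultimately show False using deg[of v] by linarith
    qed
    obtain v where v: "v \<in> e" using ne[OF e] by auto
    then have "e \<in> {e \<in> E. v \<in> e}" using e by simp
    then have "hypergraph_degree E v > 0"
      unfolding hypergraph_degree_def using assms(1) by (auto simp: card_gt_0_iff)
    then have P0: "?P 0" using v by (auto intro!: bexI[of _ v])
    define a where "a = Greatest ?P"
    have Pa: "?P a" unfolding a_def by (rule GreatestI_nat[where P = ?P, OF P0]) (rule bound)
    have "\<not> ?P (Suc a)"
    proof
      assume "?P (Suc a)"
      then have "Suc a \<le> a" unfolding a_def by (rule Greatest_le_nat[where P = ?P]) (rule bound)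
      then show False by simp
    qed
    then have "e \<in> cls a" using Pa e by (auto simp: cls_def not_le)
    moreover have "a < B"
    proof (rule ccontr)
      assume "\<not> a < B"
      then have "(2::nat) ^ B \<le> 2 ^ a" by (intro power_increasing) auto
      moreover obtain v where "2 ^ a \<le> hypergraph_degree E v" using Pa by auto
      ultimately show False using deg[of v] by linarith
    qed
    ultimately show "e \<in> (\<Union>a<B. cls a)" by auto
  qed
  moreover have "finite (\<Union>a<B. cls a)"
    using assms(1) by (auto simp: cls_def)
  ultimately have "card E \<le> card (\<Union>a<B. cls a)" by (metis card_mono)
  also have "\<dots> \<le> (\<Sum>a<B. card (cls a))" by (rule card_UN_le) simp
  finally have le: "card E \<le> (\<Sum>a<B. card (cls a))" .
  have "\<exists>a<B. card E \<le> B * card (cls a)"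
  proof (rule ccontr)
    assume "\<not> ?thesis"
    then have "B * card (cls a) < card E" if "a < B" for a using that by (meson not_le)
    then have "(\<Sum>a<B. B * card (cls a)) < (\<Sum>a<B. card E)"
      using \<open>B > 0\<close> by (intro sum_strict_mono) (auto simp: lessThan_empty_iff)
    then show False using le by (simp flip: sum_distrib_left)
  qed
  then obtain a where a: "a < B" "card E \<le> B * card (cls a)" by auto
  show ?thesis
  proof (rule that[of "cls a" a])
    show "cls a \<subseteq> E" by (auto simp: cls_def)
    show "\<exists>v\<in>e. 2 ^ a \<le> hypergraph_degree E v" if "e \<in> cls a" for e
      using that by (simp add: cls_def)
    show "hypergraph_degree (cls a) v \<le> 2 ^ Suc a" for v
    proof (cases "{e \<in> cls a. v \<in> e} = {}")
      case False
      then obtain e where "e \<in> cls a" "v \<in> e" by auto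
      then have "hypergraph_degree E v < 2 ^ Suc a" by (auto simp: cls_def)
      moreover have "hypergraph_degree (cls a) v \<le> hypergraph_degree E v"
        unfolding hypergraph_degree_def using assms(1) by (intro card_mono) (auto simp: cls_def)
      ultimately show ?thesis by simp
    qed (simp only: hypergraph_degree_def card.empty)
  qed (use a in auto)
qed

section \<open>Counting estimates\<close>

text \<open>\<open>b ^ b / fact b\<close> is one term of the exponential series at \<open>b\<close>,
  and \<open>exp 1 \<le> 3\<close>.\<close>

lemma power_le_three_power_fact: "real b ^ b \<le> 3 ^ b * fact b"
proof -
  have "(\<lambda>n. real b ^ n /\<^sub>R fact n) sums exp (real b)" by (rule exp_converges)
  then have s: "summable (\<lambda>n. real b ^ n /\<^sub>R fact n)" "(\<Sum>n. real b ^ n /\<^sub>R fact n) = exp (real b)"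
    by (auto simp: sums_iff)
  have "real b ^ b / fact b \<le> (\<Sum>n. real b ^ n /\<^sub>R fact n)"
    using sum_le_suminf[OF s(1), of "{b}"] by (simp add: field_simps)
  also have "\<dots> = exp 1 ^ b" unfolding s(2) by (simp flip: exp_of_nat_mult)
  also have "\<dots> \<le> 3 ^ b" by (intro power_mono exp_le) auto
  finally show ?thesis by (simp add: field_simps)
qed

lemma binomial_le_power_div:
  assumes "b > 0"
  shows "real (a choose b) \<le> (3 * a / b) ^ b"
proof -
  have "real (a choose b) * fact b \<le> real a ^ b"
    using binomial_fact_pow[of a b] by (metis of_nat_fact of_nat_le_iff of_nat_mult of_nat_power)
  moreover have "real (a choose b) * real b ^ b \<le> real (a choose b) * (3 ^ b * fact b)"
    by (intro mult_left_mono power_le_three_power_fact) auto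
  moreover have "real (a choose b) * (3 ^ b * fact b) = 3 ^ b * (real (a choose b) * fact b)" by simp
  ultimately have "real (a choose b) * real b ^ b \<le> 3 ^ b * real a ^ b"
    by (metis mult_left_mono order_trans zero_le_numeral zero_le_power)
  then show ?thesis using assms by (simp add: power_divide power_mult_distrib field_simps)
qed

text \<open>The \<open>N\<close>-th root of what the pigeonhole step requires. In the application
  \<open>e\<close> and \<open>e'\<close> are the sizes of the hypergraph and of its dyadic class,
  \<open>\<alpha>\<close> that of \<open>A\<close>, and \<open>\<kappa>\<close> is the uniformity.
  Eliminating \<open>\<alpha>\<close> and \<open>N\<close> leaves \<open>\<Delta> ^ j\<close>
  against \<open>e' ^ (j + 2)\<close>; then \<open>\<Delta> \<le> 2 * n\<close> and
  \<open>e \<le> B * e'\<close> give the exponents of \<open>n\<close> and \<open>B\<close>.\<close>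

lemma matchings_numerics:
  fixes e e' n \<Delta> \<alpha> B r N \<kappa> :: real and j :: nat
  assumes pos: "e > 0" "n > 0" "\<Delta> > 0" "B > 0" "r > 0" "N > 0" "\<kappa> > 0" "\<alpha> \<ge> 0" "e' > 0"
    and "e \<le> B * e'" and \<alpha>: "\<alpha> * \<Delta> \<le> 2 * \<kappa> * e" and "\<Delta> \<le> 2 * n" and N: "e' \<le> 4 * \<kappa> * \<Delta> * N"
    and big: "128 * \<kappa> * 3 ^ (j + 2) * (4 * \<kappa>) ^ Suc j * 2 ^ j * r * B ^ (j + 3) * n ^ (2 * j + 1) < e ^ Suc j"
  shows "32 * r * B * (3 * \<alpha> / N) * (3 * n / N) ^ Suc j < e' / (2 * N)"
proof -
  let ?c = "128 * \<kappa> * 3 ^ (j + 2) * (4 * \<kappa>) ^ Suc j"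
  have "?c * r * B * e * n ^ Suc j * \<Delta> ^ j * B ^ (j + 2)
      \<le> ?c * r * B * e * n ^ Suc j * (2 * n) ^ j * B ^ (j + 2)"
    using pos assms by (intro mult_left_mono mult_right_mono power_mono) auto
  also have "\<dots> = e * (?c * 2 ^ j * r * B ^ (j + 3) * n ^ (2 * j + 1))"
  proof -
    have *: "B ^ (j + 3) = B * B ^ (j + 2)" "n ^ (2 * j + 1) = n ^ Suc j * n ^ j"
      by (simp_all add: power_add mult_2 mult_ac eval_nat_numeral)
    show ?thesis unfolding * by (simp only: power_mult_distrib mult_ac)
  qed
  also have "\<dots> < e * e ^ Suc j" using big pos by (intro mult_strict_left_mono) auto
  also have "\<dots> = e ^ (j + 2)" by simp
  also have "\<dots> \<le> (B * e') ^ (j + 2)" using pos assms by (intro power_mono) auto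
  also have "\<dots> = B ^ (j + 2) * (e' * e' ^ Suc j)" by (simp add: power_mult_distrib)
  also have "\<dots> \<le> B ^ (j + 2) * (e' * (4 * \<kappa> * \<Delta> * N) ^ Suc j)"
    using pos N by (intro mult_left_mono power_mono) auto
  finally have "?c * r * B * e * n ^ Suc j * \<Delta> ^ j * B ^ (j + 2)
      < (4 * \<kappa>) ^ Suc j * \<Delta> ^ j * B ^ (j + 2) * (\<Delta> * (e' * N ^ Suc j))"
    by (simp add: power_mult_distrib mult_ac)
  then have "(4 * \<kappa>) ^ Suc j * \<Delta> ^ j * B ^ (j + 2) * (128 * \<kappa> * 3 ^ (j + 2) * r * B * e * n ^ Suc j)
      < (4 * \<kappa>) ^ Suc j * \<Delta> ^ j * B ^ (j + 2) * (\<Delta> * (e' * N ^ Suc j))"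
    by (simp add: mult_ac)
  then have main: "128 * \<kappa> * 3 ^ (j + 2) * r * B * e * n ^ Suc j < \<Delta> * (e' * N ^ Suc j)"
    using pos by (subst (asm) mult_less_cancel_left_pos) auto
  \<comment> \<open>The factor \<open>\<Delta>\<close> brings in the bound on
    \<open>\<alpha> * \<Delta>\<close> and is cancelled afterwards.\<close>
  have "\<Delta> * (64 * 3 ^ (j + 2) * r * B * \<alpha> * n ^ Suc j) = 64 * 3 ^ (j + 2) * r * B * n ^ Suc j * (\<alpha> * \<Delta>)"
    by (simp add: mult_ac)
  also have "\<dots> \<le> 64 * 3 ^ (j + 2) * r * B * n ^ Suc j * (2 * \<kappa> * e)"
    using pos \<alpha> by (intro mult_left_mono) auto
  also have "\<dots> = 128 * \<kappa> * 3 ^ (j + 2) * r * B * e * n ^ Suc j" by (simp add: mult_ac)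
  also note main
  finally have "64 * 3 ^ (j + 2) * r * B * \<alpha> * n ^ Suc j < e' * N ^ Suc j"
    using pos by (subst (asm) mult_less_cancel_left_pos) auto
  then show ?thesis using pos by (simp add: field_simps power_divide power_mult_distrib)
qed

section \<open>Choice of parameters and conclusion\<close>

text \<open>Here \<open>k - 1 = j + 1\<close>, and \<open>big\<close> is an edge bound raised to
  that power, free of real exponents. The number \<open>B\<close>, an upper bound for the binary
  logarithm of \<open>card V\<close>, serves twice: degrees below \<open>2 ^ B\<close> give
  \<open>B\<close> dyadic classes, and \<open>N < 2 ^ B\<close> lets \<open>B\<close> be the
  \<open>l\<close> of the sunflower lemma.\<close>

lemma regular_subhypergraph_of_many_edges:
  fixes V :: "'a set" and E :: "'a set set" and j r B :: nat
  defines "\<kappa> \<equiv> real (j + 2)"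
  assumes "hypergraph V E" and "uniform_hypergraph (j + 2) E" and lin: "linear_hypergraph E"
    and B: "card V < 2 ^ B" "B > 0" and "r > 0" "V \<noteq> {}"
    and big: "128 * \<kappa> * 3 ^ (j + 2) * (4 * \<kappa>) ^ Suc j * 2 ^ j * real r * real B ^ (j + 3) * real (card V) ^ (2 * j + 1)
      < real (card E) ^ Suc j"
  shows "\<exists>W F. subhypergraph W F E \<and> regular_hypergraph r W F"
proof -
  define k where "k = j + 2"
  have finV: "finite V" and E: "\<And>e. e \<in> E \<Longrightarrow> e \<subseteq> V \<and> card e = k"
    using assms(2,3) by (auto simp: hypergraph_def uniform_hypergraph_def k_def)
  have k: "k \<ge> 2" "\<kappa> = real k" by (auto simp: k_def \<kappa>_def)
  have finE: "finite E" using E finV by (intro finite_subset[of E "Pow V"]) auto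
  define n where "n = card V"
  have n: "n > 0" using finV \<open>V \<noteq> {}\<close> by (simp add: n_def card_gt_0_iff)
  have deg: "hypergraph_degree E v \<le> n" for v
    unfolding n_def by (rule linear_hypergraph_degree_le[OF finV E k(1) lin])
  have ne: "e \<noteq> {}" if "e \<in> E" for e using E[OF that] k by auto
  obtain a E' where E': "E' \<subseteq> E" "card E \<le> B * card E'" "a < B"
    "\<And>e. e \<in> E' \<Longrightarrow> \<exists>v\<in>e. 2 ^ a \<le> hypergraph_degree E v"
    "\<And>v. hypergraph_degree E' v \<le> 2 ^ Suc a"
    using obtain_dyadic_class[OF finE ne B(2), of thesis] deg B(1) le_less_trans unfolding n_def by blast
  define \<Delta> :: nat where "\<Delta> = 2 ^ Suc a"
  define A where "A = {v \<in> V. 2 ^ a \<le> hypergraph_degree E v}"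
  have \<Delta>: "\<Delta> > 0" by (simp add: \<Delta>_def)
  have finE': "finite E'" using E'(1) finE finite_subset by blast
  have "card A * 2 ^ a \<le> (\<Sum>v\<in>A. hypergraph_degree E v)"
    using sum_bounded_below[of A "2 ^ a" "hypergraph_degree E"] by (simp add: A_def)
  also have "\<dots> \<le> (\<Sum>v\<in>V. hypergraph_degree E v)"
    using finV by (intro sum_mono2) (auto simp: A_def)
  also have "\<dots> = k * card E" by (rule sum_hypergraph_degree[OF finV E])
  finally have cardA: "card A * \<Delta> \<le> 2 * k * card E" by (simp add: \<Delta>_def)
  \<comment> \<open>A crude use of \<open>big\<close>: it yields \<open>card E' > 4 * k * n\<close>,
    which makes the matching size \<open>N\<close> below positive.\<close>
  have "(4 * \<kappa> * n * B) ^ Suc j = 1 * ((4 * \<kappa>) ^ Suc j * real B ^ Suc j * real n ^ Suc j)"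
    by (simp add: power_mult_distrib)
  also have "\<dots> \<le> (128 * \<kappa> * 3 ^ (j + 2) * 2 ^ j * real r) * ((4 * \<kappa>) ^ Suc j * real B ^ (j + 3) * real n ^ (2 * j + 1))"
  proof (rule mult_mono)
    have "1 \<le> \<kappa>" "1 \<le> (128::real)" by (auto simp: \<kappa>_def)
    moreover have "1 \<le> (3::real) ^ (j + 2)" "1 \<le> (2::real) ^ j"
      by (rule one_le_power, simp)+
    moreover have "1 \<le> real r" using \<open>r > 0\<close> by simp
    ultimately show "1 \<le> 128 * \<kappa> * 3 ^ (j + 2) * 2 ^ j * real r"
      by (intro mult_ge1_I)
    show "(4 * \<kappa>) ^ Suc j * real B ^ Suc j * real n ^ Suc j
        \<le> (4 * \<kappa>) ^ Suc j * real B ^ (j + 3) * real n ^ (2 * j + 1)"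
      using B n k by (intro mult_mono power_increasing order_refl) auto
  qed (auto simp: \<kappa>_def)
  also have "\<dots> < real (card E) ^ Suc j" using big by (simp only: n_def mult_ac)
  finally have e4: "4 * \<kappa> * n * B < real (card E)"
    by (rule power_less_imp_less_base) simp
  have "real (card E) \<le> B * card E'" using E'(2) by (metis of_nat_le_iff of_nat_mult)
  with e4 have "B * (4 * \<kappa> * n) < B * card E'" by (simp add: mult_ac)
  then have e'4: "4 * \<kappa> * n < card E'" using B by simp
  then have "4 * k * n < card E'" unfolding k(2) by (metis of_nat_less_iff of_nat_mult of_nat_numeral)
  then have "E' \<noteq> {}" by auto
  then obtain e0 v0 where "e0 \<in> E'" "2 ^ a \<le> hypergraph_degree E v0" using E'(4) by blast
  then have \<Delta>n: "\<Delta> \<le> 2 * n" using deg[of v0] by (simp add: \<Delta>_def)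
  \<comment> \<open>The largest \<open>N\<close> allowed in the count of matchings. As
    \<open>N\<close> is positive, rounding loses at most a factor 2, which is
    \<open>N2\<close>.\<close>
  define N where "N = card E' div (2 * k * \<Delta>)"
  have "2 * k * \<Delta> \<le> 4 * k * n" using \<Delta>n by simp
  then have "2 * k * \<Delta> \<le> card E'" using \<open>4 * k * n < card E'\<close> by linarith
  then have N: "N > 0" unfolding N_def using \<Delta> k by (simp add: div_greater_zero_iff)
  have N1: "2 * N * k * \<Delta> \<le> card E'"
    using div_times_less_eq_dividend[of "card E'" "2 * k * \<Delta>"] by (simp add: N_def mult_ac)
  have "card E' < 2 * k * \<Delta> + 2 * k * \<Delta> * (card E' div (2 * k * \<Delta>))"
    by (rule dividend_less_times_div) (use \<Delta> k in simp)
  also have "\<dots> = 2 * k * \<Delta> * Suc N" by (simp add: N_def)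
  also have "\<dots> \<le> 2 * k * \<Delta> * (2 * N)" using N by (intro mult_left_mono) auto
  finally have N2: "card E' \<le> 4 * k * \<Delta> * N" by simp
  have E'V: "e \<subseteq> V \<and> card e = k" if "e \<in> E'" for e using E E'(1) that by blast
  \<comment> \<open>Summing the degrees in \<open>E'\<close> bounds \<open>N\<close> by
    \<open>n\<close>, hence below \<open>2 ^ B\<close>.\<close>
  have "card E' \<le> k * card E'" using k by simp
  with N1 have "2 * N * k * \<Delta> \<le> k * card E'" by linarith
  also have "\<dots> = (\<Sum>v\<in>V. hypergraph_degree E' v)" by (rule sum_hypergraph_degree[OF finV E'V, symmetric])
  also have "\<dots> \<le> n * \<Delta>" using sum_bounded_above[of V "hypergraph_degree E'" \<Delta>] E'(5) by (simp add: n_def \<Delta>_def)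
  finally have "2 * N * k \<le> n" using \<Delta> by simp
  moreover have "N \<le> 2 * N * k" using k by simp
  ultimately have "N \<le> n" by linarith
  then have NB: "N < 2 ^ B" using B by (simp add: n_def)
  let ?m = "card (matchings E' N)"
  \<comment> \<open>\<open>?x ^ N\<close> bounds the left side of the pigeonhole condition, so the
    comparison reduces to one of \<open>N\<close>-th roots.\<close>
  let ?x = "32 * real r * real B * (3 * real (card A) / N) * (3 * real n / N) ^ Suc j"
  have "real (card E') ^ N \<le> 2 ^ N * fact N * real ?m"
  proof -
    have "card E' ^ N \<le> 2 ^ N * fact N * ?m"
    proof (rule power_card_le_matchings[OF finE' _ _ _ N1])
      show "finite e \<and> card e = k" if "e \<in> E'" for e
        using E'V[OF that] finV finite_subset by blast
      show "hypergraph_degree E' v \<le> \<Delta>" for v using E'(5) by (simp add: \<Delta>_def)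
    qed (use k in simp)
    then have "real (card E' ^ N) \<le> real (2 ^ N * fact N * ?m)" by (rule of_nat_mono)
    then show ?thesis by simp
  qed
  also have "\<dots> \<le> 2 ^ N * real (N ^ N) * real ?m"
    by (intro mult_right_mono mult_left_mono fact_le_power) auto
  finally have "(card E' / (2 * real N)) ^ N \<le> ?m"
    using N by (simp add: power_divide power_mult_distrib field_simps)
  moreover have "?x < card E' / (2 * real N)"
  proof (rule matchings_numerics[where \<kappa> = \<kappa> and \<Delta> = \<Delta> and e = "card E"])
    show "real (card A) * real \<Delta> \<le> 2 * \<kappa> * real (card E)"
      using of_nat_mono[OF cardA, where 'a = real] by (simp add: k)
    show "real (card E') \<le> 4 * \<kappa> * real \<Delta> * real N"
      using of_nat_mono[OF N2, where 'a = real] by (simp add: k)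
    show "real \<Delta> \<le> 2 * real n" using \<Delta>n by simp
    have "0 \<le> 4 * \<kappa> * n * B" by (simp add: \<kappa>_def)
    with e4 show "real (card E) > 0" by linarith
    show "real (card E') > 0" using \<open>4 * k * n < card E'\<close> by simp
  qed (use big n \<Delta> B N k \<open>r > 0\<close> \<open>real (card E) \<le> B * card E'\<close> in \<open>auto simp: n_def\<close>)
  then have "?x ^ N < (card E' / (2 * real N)) ^ N"
    using N by (intro power_strict_mono) auto
  moreover have "real ((32 * r * B) ^ N * ((card A choose N) * (card V choose ((k - 1) * N)))) \<le> ?x ^ N"
  proof -
    have kN: "(k - 1) * N = Suc j * N" by (simp add: k_def)
    have "real (card V choose ((k - 1) * N)) \<le> (3 * real n / real (Suc j * N)) ^ (Suc j * N)"
      unfolding kN n_def using N binomial_le_power_div[of "Suc j * N" "card V"] by simp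
    also have "\<dots> \<le> (3 * real n / real N) ^ (Suc j * N)"
      using N by (intro power_mono frac_le) auto
    finally have V: "real (card V choose ((k - 1) * N)) \<le> ((3 * real n / real N) ^ Suc j) ^ N"
      by (simp only: power_mult)
    have "real ((32 * r * B) ^ N * ((card A choose N) * (card V choose ((k - 1) * N))))
        = (32 * real r * real B) ^ N * (real (card A choose N) * real (card V choose ((k - 1) * N)))"
      by simp
    also have "\<dots> \<le> (32 * real r * real B) ^ N * ((3 * real (card A) / real N) ^ N * ((3 * real n / real N) ^ Suc j) ^ N)"
      using V binomial_le_power_div[OF N, of "card A"] by (intro mult_left_mono mult_mono) auto
    also have "\<dots> = ?x ^ N" by (simp only: power_mult_distrib mult_ac)
    finally show ?thesis .
  qed
  ultimately have many: "(32 * r * B) ^ N * ((card A choose N) * (card V choose ((k - 1) * N))) < ?m"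
    by (smt (verit) of_nat_less_iff)
  have "\<exists>W F. subhypergraph W F E' \<and> regular_hypergraph r W F"
  proof (rule regular_subhypergraph_of_many_matchings[OF finV _ _ _ \<open>r > 0\<close> NB many])
    show "e \<subseteq> V \<and> card e = k \<and> e \<inter> A \<noteq> {}" if "e \<in> E'" for e
      using E'V[OF that] E'(4)[OF that] by (auto simp: A_def)
  qed (use k in \<open>auto simp: A_def\<close>)
  then show ?thesis using E'(1) by (auto simp: subhypergraph_def)
qed

text \<open>The edge bound is raised to the power \<open>k - 1\<close> to reach the integer form
  above. The condition \<open>n \<ge> 2\<close> keeps the logarithm positive: for
  \<open>n = 1\<close> the bound would be 0, and the empty edge set has no regular
  subhypergraph.\<close>

theorem theorem5p5:
  fixes k :: nat
  assumes "k \<ge> 2"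
  shows "\<exists>c::real. c > 0 \<and>
    (\<forall>(r::nat) (n::nat) (V :: 'a set) (E :: 'a set set).
       r > 0 \<longrightarrow> n \<ge> 2 \<longrightarrow>
       hypergraph V E \<longrightarrow> card V = n \<longrightarrow> uniform_hypergraph k E \<longrightarrow> linear_hypergraph E \<longrightarrow>
       real (card E) \<ge> c * real r powr (1 / (real k - 1))
                         * real n powr (2 - 1 / (real k - 1))
                         * ln (real n) powr (2 * real k + 1 / (real k - 1)) \<longrightarrow>
       (\<exists>W F. subhypergraph W F E \<and> regular_hypergraph r W F))"
proof -
  obtain j where k: "k = j + 2" using assms by (metis add.commute le_Suc_ex)
  define \<kappa> where "\<kappa> = real (j + 2)"
  define C where "C = 128 * \<kappa> * 3 ^ (j + 2) * (4 * \<kappa>) ^ Suc j * 2 ^ j"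
  \<comment> \<open>\<open>p\<close> is the exponent of the logarithm after raising to the power
    \<open>j + 1\<close>. Only \<open>j + 3\<close> of it pays for the powers of \<open>B\<close>;
    \<open>q\<close> is the surplus.\<close>
  define p where "p = 2 * k * Suc j + 1"
  define q where "q = p - (j + 3)"
  have p: "p = q + (j + 3)" by (simp add: p_def q_def k)
  have C: "C > 0" by (simp add: C_def \<kappa>_def)
  \<comment> \<open>\<open>C + 1\<close> makes the comparison strict, \<open>4 ^ (j + 3)\<close>
    pays for \<open>B \<le> 4 * L\<close>, and \<open>2 ^ q\<close> turns the surplus into
    \<open>(2 * L) ^ q \<ge> 1\<close>.\<close>
  define c where "c = (C + 1) * 4 ^ (j + 3) * 2 ^ q"
  have c: "c > 0" "c \<ge> 1" using C by (auto simp: c_def intro!: mult_ge1_I)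
  have "\<exists>W F. subhypergraph W F E \<and> regular_hypergraph r W F"
    if r: "r > 0" and n: "n \<ge> 2" and V: "hypergraph V E" "card V = n"
      and E: "uniform_hypergraph k E" "linear_hypergraph E"
      and big: "real (card E) \<ge> c * real r powr (1 / (real k - 1))
        * real n powr (2 - 1 / (real k - 1)) * ln (real n) powr (2 * real k + 1 / (real k - 1))"
    for r n :: nat and V :: "'a set" and E
  proof -
    define L where "L = ln (real n)"
    have "exp (1 / 2) \<le> real n" using exp_half_le2 n by linarith
    then have L: "L \<ge> 1 / 2" unfolding L_def using n by (subst ln_ge_iff) auto
    obtain b where b: "2 ^ b \<le> n" "n < 2 ^ (b + 1)" using ex_power_ivl1[of 2 n] n by auto
    define B where "B = Suc b"
    have "real b * ln 2 \<le> L"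
    proof -
      have "2 ^ b \<le> real n" using of_nat_mono[OF b(1), where 'a = real] by simp
      then have "ln (2 ^ b) \<le> ln (real n)" using n by (subst ln_le_cancel_iff) auto
      then show ?thesis by (simp add: L_def ln_realpow)
    qed
    moreover have "ln 2 \<ge> (1 / 2 :: real)" using exp_half_le2 by (subst ln_ge_iff) auto
    then have "real b * (1 / 2) \<le> real b * ln 2" by (intro mult_left_mono) auto
    \<comment> \<open>\<open>b \<le> 2 * L\<close> and \<open>1 \<le> 2 * L\<close> add up to
      \<open>B = b + 1 \<le> 4 * L\<close>.\<close>
    ultimately have BL: "real B \<le> 4 * L" using L by (simp add: B_def)
    have kj: "real k - 1 = real (Suc j)" by (simp add: k)
    \<comment> \<open>\<open>c \<ge> 1\<close> allows \<open>c\<close> to be replaced by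
      \<open>c ^ Suc j\<close>, so that the product becomes the \<open>Suc j\<close>-th power of the
      edge bound.\<close>
    have "c * (real r * real n ^ (2 * j + 1) * L ^ p)
        \<le> c ^ Suc j * (real r * real n ^ (2 * j + 1) * L ^ p)"
      using c L power_increasing[of 1 "Suc j" c] by (intro mult_right_mono) auto
    also have "\<dots> = (c * real r powr (1 / (real k - 1)) * real n powr (2 - 1 / (real k - 1))
        * L powr (2 * real k + 1 / (real k - 1))) ^ Suc j"
    proof -
      have pw: "(x powr y) ^ Suc j = x powr (y * real (Suc j))" if "x > 0" for x y :: real
        using that by (subst powr_power) (auto simp: mult.commute)
      have "(real r powr (1 / (real k - 1))) ^ Suc j = real r"
        using r unfolding kj by (subst pw) auto
      moreover have "(real n powr (2 - 1 / (real k - 1))) ^ Suc j = real n powr real (2 * j + 1)"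
        using n unfolding kj by (subst pw) (auto simp: field_simps intro!: arg_cong[of _ _ "(powr) (real n)"])
      moreover have "\<dots> = real n ^ (2 * j + 1)" using n by (intro powr_realpow) auto
      moreover have "(L powr (2 * real k + 1 / (real k - 1))) ^ Suc j = L powr real p"
        using L unfolding kj by (subst pw) (auto simp: field_simps p_def intro!: arg_cong[of _ _ "(powr) L"])
      moreover have "\<dots> = L ^ p" using L by (intro powr_realpow) auto
      ultimately show ?thesis by (simp only: power_mult_distrib mult.assoc)
    qed
    also have "\<dots> \<le> real (card E) ^ Suc j"
      using big c by (intro power_mono) (auto simp: L_def)
    finally have main: "c * (real r * real n ^ (2 * j + 1) * L ^ p) \<le> real (card E) ^ Suc j" .
    have "real B ^ (j + 3) * 1 \<le> (4 * L) ^ (j + 3) * (2 * L) ^ q"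
      using BL L by (intro mult_mono power_mono one_le_power) auto
    then have BLp: "real B ^ (j + 3) \<le> 4 ^ (j + 3) * 2 ^ q * L ^ p"
      by (simp add: p power_add power_mult_distrib mult_ac)
    have "C * real r * real B ^ (j + 3) * real n ^ (2 * j + 1)
        < (C + 1) * (real r * real n ^ (2 * j + 1)) * real B ^ (j + 3)"
      using r n by (simp add: algebra_simps B_def)
    also have "\<dots> \<le> (C + 1) * (real r * real n ^ (2 * j + 1)) * (4 ^ (j + 3) * 2 ^ q * L ^ p)"
      using C by (intro mult_left_mono BLp) auto
    also have "\<dots> = c * (real r * real n ^ (2 * j + 1) * L ^ p)" by (simp only: c_def mult_ac)
    also note main
    finally have "C * real r * real B ^ (j + 3) * real (card V) ^ (2 * j + 1) < real (card E) ^ Suc j"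
      by (simp only: V)
    then show ?thesis
      using V E n b r unfolding C_def \<kappa>_def k
      by (intro regular_subhypergraph_of_many_edges[where j = j and B = B and V = V]) (auto simp: B_def)
  qed
  then show ?thesis using c(1) by blast
qed

end
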